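(* Let $n \geq 2$ be an integer. A real number $\beta \in \left(1, \frac{1+\sqrt{5}}{2}\right]$ belongs to the interval $[\theta_{n+1}^{-1}, \theta_n^{-1})$ if and only if the Rényi $\beta$-expansion of unity $d_\beta(1)$ is of the form $$d_\beta(1) = 0.1\,0^{n-1}\,1\,0^{n_1}\,1\,0^{n_2}\,1\,0^{n_3}\ldots$$ with $n_k \geq n-1$ for all $k \geq 1$.
   Context: For an integer $m \geq 2$, $\theta_m$ denotes the unique zero in $(0,1)$ of the trinomial $-1 + x + x^m$. For a real $\beta > 1$, the $\beta$-transformation is $T_\beta(x) = \beta x \bmod 1$ on $[0,1]$, and the Rényi $\beta$-expansion of unity is $d_\beta(1) = 0.t_1 t_2 t_3\ldots$ where $t_1 = \lfloor \beta \rfloor$ and $t_{i} = \lfloor \beta T_\beta^{i-1}(1) \rfloor$ for $i\ge 2$, so that $1 = \sum_{i \geq 1} t_i \beta^{-i}$ (a finite expansion is followed by zeros). The notation $0^k$ denotes a block of $k$ consecutive digits $0$. *)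

theory Defs
  imports Complex_Main "HOL-Library.Stream"
begin

definition theta :: "nat \<Rightarrow> real" where
  "theta m = (THE x. x \<in> {0<..<1} \<and> - 1 + x + x ^ m = 0)"

lemma theta_ex1:
  assumes "m \<ge> 2"
  shows "\<exists>!x::real. x \<in> {0<..<1} \<and> - 1 + x + x ^ m = 0"
proof (rule ex_ex1I)
  let ?f = "\<lambda>x::real. - 1 + x + x ^ m"
  have "\<exists>x\<ge>0. x \<le> 1 \<and> ?f x = 0"
    by (rule IVT') (use assms in \<open>auto simp: power_0_left intro!: continuous_intros\<close>)
  then obtain x :: real where x: "0 \<le> x" "x \<le> 1" "?f x = 0" by blast
  have "x \<noteq> 0" "x \<noteq> 1" using x assms by (auto simp: power_0_left)
  with x show "\<exists>x. x \<in> {0<..<1} \<and> ?f x = 0" by (intro exI[of _ x]) auto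
next
  fix x y :: real
  assume *: "x \<in> {0<..<1} \<and> - 1 + x + x ^ m = 0" "y \<in> {0<..<1} \<and> - 1 + y + y ^ m = 0"
  have "x \<le> y \<longrightarrow> x ^ m \<le> y ^ m" "y \<le> x \<longrightarrow> y ^ m \<le> x ^ m"
    using * by (auto intro!: power_mono)
  with * show "x = y" by linarith
qed

definition beta_transformation :: "real \<Rightarrow> real \<Rightarrow> real" where
  "beta_transformation \<beta> x = frac (\<beta> * x)"

(* Digits are indexed from 1; since the 0-th iterate of 1 is 1, the first digit is floor \<beta>. *)
definition renyi_digit :: "real \<Rightarrow> nat \<Rightarrow> int" where
  "renyi_digit \<beta> i = \<lfloor>\<beta> * (beta_transformation \<beta> ^^ (i - 1)) 1\<rfloor>"

definition renyi_expansion :: "real \<Rightarrow> int stream" where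
  "renyi_expansion \<beta> = smap (renyi_digit \<beta>) (fromN 1)"

abbreviation zeros :: "nat \<Rightarrow> int list" where
  "zeros k \<equiv> replicate k 0"

(* The words  1 0^(n-1) 1 0^(n_1) 1 0^(n_2) ...  with n_k >= n - 1 for all k >= 1.
   A finite expansion  1 0^(n-1) 1 0^(n_1) ... 1 0^(n_K) 1  (K >= 0) is followed by zeros;
   this case cannot be dropped: for \<beta> = 1 / theta (n + 1) the expansion is  1 0^(n-1) 1. *)
definition lacunary_form :: "nat \<Rightarrow> int stream \<Rightarrow> bool" where
  "lacunary_form n d \<longleftrightarrow>
     (\<exists>ns :: nat \<Rightarrow> nat. (\<forall>k\<ge>1. ns k \<ge> n - 1) \<and>
        (d = (1 # zeros (n - 1)) @- flat (smap (\<lambda>k. 1 # zeros (ns k)) (fromN 1)) \<or>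
         (\<exists>K. d = (1 # zeros (n - 1)) @- concat (map (\<lambda>k. 1 # zeros (ns k)) [1..<K + 1])
                    @- [1] @- sconst 0)))"

end

(* T(1) = \<beta> - 1, and as long as the digit produced is 0 the transformation is multiplication by \<beta>.
   So d(1) begins with 1 0^(n-1) 1 iff \<beta>^(n-1) (\<beta> - 1) < 1 <= \<beta>^n (\<beta> - 1), which are the two bounds
   on \<beta> by inverse (theta n) and inverse (theta (n + 1)). The later gaps come for free: a digit 1
   produced at a point x < 1 leaves T x = \<beta> x - 1 < \<beta> - 1, so at least n - 1 zeros follow it. *)
theory Submission
  imports Defs
begin

section \<open>The \<open>\<beta>\<close>-transformation\<close>

text \<open>A digit 0 means that no integer part is removed, so the orbit is just multiplied by
  \<open>\<beta>\<close>. As \<open>\<beta> ^ j * y\<close> is nondecreasing in \<open>j\<close>,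
  the last condition implies all earlier ones. The claims share one induction because the digit
  claim needs the closed form of the orbit.\<close>

lemma floor_funpow_beta_eq_0_iff:
  assumes "\<beta> \<ge> 1" "0 \<le> y" "y < 1"
  shows "(\<forall>j<m. \<lfloor>\<beta> * (beta_transformation \<beta> ^^ j) y\<rfloor> = 0) \<longleftrightarrow> \<beta> ^ m * y < 1"
    and "\<beta> ^ m * y < 1 \<Longrightarrow> (beta_transformation \<beta> ^^ m) y = \<beta> ^ m * y"
proof (induction m)
  case 0
  { case 1 show ?case using assms by simp }
  { case 2 show ?case by simp }
next
  case (Suc m)
  have mono: "\<beta> ^ m * y < 1" if "\<beta> ^ Suc m * y < 1"
  proof -
    have "\<beta> ^ m * y \<le> \<beta> ^ Suc m * y"
      using assms by (intro mult_right_mono power_increasing) auto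
    then show ?thesis using that by linarith
  qed
  have floor0: "\<lfloor>\<beta> ^ Suc m * y\<rfloor> = 0 \<longleftrightarrow> \<beta> ^ Suc m * y < 1"
    using assms by (auto simp: floor_eq_iff)
  {
    case 1
    show ?case
    proof (cases "\<beta> ^ m * y < 1")
      case True
      then have "\<lfloor>\<beta> * (beta_transformation \<beta> ^^ m) y\<rfloor> = 0 \<longleftrightarrow> \<beta> ^ Suc m * y < 1"
        using Suc.IH(2) floor0 by (simp add: mult.assoc)
      then show ?thesis using Suc.IH(1) True by (simp only: less_Suc_eq) blast
    next
      case False
      \<comment> \<open>Both sides fail: a nonzero digit already occurs before position
        \<open>m\<close>, and the larger power is at least 1 as well.\<close>
      then show ?thesis using Suc.IH(1) mono by (meson less_SucI)
    qed
  next
    case 2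
    then have "(beta_transformation \<beta> ^^ Suc m) y = frac (\<beta> ^ Suc m * y)"
      using Suc.IH(2) mono by (simp add: beta_transformation_def[of \<beta> "\<beta> ^ m * y"] mult.assoc)
    also have "\<dots> = \<beta> ^ Suc m * y"
      using 2 assms by (simp add: frac_eq)
    finally show ?case .
  }
qed

lemma funpow_beta_transformation_bounds:
  assumes "i > 0"
  shows "0 \<le> (beta_transformation \<beta> ^^ i) x" "(beta_transformation \<beta> ^^ i) x < 1"
  using assms by (cases i; simp add: beta_transformation_def frac_lt_1)+

text \<open>Stream positions start at 0, so position \<open>i\<close> carries the digit numbered
  \<open>i + 1\<close>; the second 1 of the lacunary form therefore sits at position
  \<open>n\<close>.\<close>

lemma snth_renyi_expansion:
  "renyi_expansion \<beta> !! i = \<lfloor>\<beta> * (beta_transformation \<beta> ^^ i) 1\<rfloor>"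
  by (simp add: renyi_expansion_def renyi_digit_def)

lemma snth_renyi_expansion_cases:
  assumes "1 < \<beta>" "\<beta> < 2"
  shows "renyi_expansion \<beta> !! i \<in> {0, 1}"
proof -
  define x where "x = (beta_transformation \<beta> ^^ i) 1"
  have "0 \<le> x \<and> x \<le> 1"
    using funpow_beta_transformation_bounds[of i \<beta> 1] by (cases "i = 0") (auto simp: x_def)
  then have "0 \<le> \<beta> * x" "\<beta> * x \<le> \<beta>"
    using assms by auto
  then have "\<lfloor>\<beta> * x\<rfloor> = 0 \<or> \<lfloor>\<beta> * x\<rfloor> = 1" using assms(2) by linarith
  then show ?thesis by (simp add: snth_renyi_expansion x_def)
qed

text \<open>The orbit restarts at the point reached after position \<open>i\<close>. The index
  \<open>Suc i\<close> ensures that this point lies in [0,1), which the starting point 1 does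
  not.\<close>

lemma zeros_after_renyi_digit_iff:
  assumes "\<beta> > 1"
  shows "(\<forall>j<m. renyi_expansion \<beta> !! (Suc i + j) = 0)
    \<longleftrightarrow> \<beta> ^ m * (beta_transformation \<beta> ^^ Suc i) 1 < 1"
proof -
  have "(beta_transformation \<beta> ^^ (Suc i + j)) 1
      = (beta_transformation \<beta> ^^ j) ((beta_transformation \<beta> ^^ Suc i) 1)" for j
    by (subst add.commute) (simp only: funpow_add o_apply)
  then show ?thesis
    unfolding snth_renyi_expansion
    using floor_funpow_beta_eq_0_iff(1)[of \<beta> "(beta_transformation \<beta> ^^ Suc i) 1" m]
      funpow_beta_transformation_bounds[of "Suc i" \<beta> 1] assms
    by simp
qed

lemma beta_transformation_one:
  assumes "1 < \<beta>" "\<beta> < 2"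
  shows "beta_transformation \<beta> 1 = \<beta> - 1"
  using assms by (simp add: beta_transformation_def frac_unique_iff)

text \<open>Since the digits are 0 or 1, a 1 at position \<open>n\<close> says that the run of
  \<open>n - 1\<close> zeros does not extend to \<open>n\<close> zeros. This negates the same
  criterion with exponent \<open>n\<close>.\<close>

lemma renyi_expansion_prefix_iff:
  assumes "1 < \<beta>" "\<beta> < 2" "n \<ge> 1"
  shows "(\<forall>j<n - 1. renyi_expansion \<beta> !! Suc j = 0) \<and> renyi_expansion \<beta> !! n = 1
    \<longleftrightarrow> \<beta> ^ (n - 1) * (\<beta> - 1) < 1 \<and> \<beta> ^ n * (\<beta> - 1) \<ge> 1"
proof -
  have *: "(\<forall>j<m. renyi_expansion \<beta> !! Suc j = 0) \<longleftrightarrow> \<beta> ^ m * (\<beta> - 1) < 1" for m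
    using zeros_after_renyi_digit_iff[of \<beta> m 0] assms by (simp add: beta_transformation_one)
  have "(\<forall>j<n. renyi_expansion \<beta> !! Suc j = 0)
      \<longleftrightarrow> (\<forall>j<n - 1. renyi_expansion \<beta> !! Suc j = 0) \<and> renyi_expansion \<beta> !! n = 0"
    using assms(3) by (cases n) (auto simp: less_Suc_eq)
  then show ?thesis
    using *[of n] *[of "n - 1"] snth_renyi_expansion_cases[OF assms(1,2), of n] by auto
qed

lemma zeros_after_one:
  assumes "1 < \<beta>" "\<beta> < 2" "\<beta> ^ m * (\<beta> - 1) < 1"
    and "renyi_expansion \<beta> !! i = 1" "i < j" "j \<le> i + m"
  shows "renyi_expansion \<beta> !! j = 0"
proof -
  define x where "x = (beta_transformation \<beta> ^^ i) 1"
  \<comment> \<open>Equality occurs at \<open>i = 0\<close>; this way the first digit 1 is covered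
    too.\<close>
  have "x \<le> 1"
    using funpow_beta_transformation_bounds(2)[of i \<beta> 1] by (cases "i = 0") (auto simp: x_def)
  moreover have "\<lfloor>\<beta> * x\<rfloor> = 1"
    using assms by (simp add: snth_renyi_expansion x_def)
  then have "(beta_transformation \<beta> ^^ Suc i) 1 = \<beta> * x - 1"
    by (simp add: beta_transformation_def frac_def x_def)
  ultimately have "(beta_transformation \<beta> ^^ Suc i) 1 \<le> \<beta> - 1"
    using assms mult_left_le[of x \<beta>] by simp
  then have "\<beta> ^ m * (beta_transformation \<beta> ^^ Suc i) 1 \<le> \<beta> ^ m * (\<beta> - 1)"
    using assms(1) by (intro mult_left_mono) auto
  then have "\<beta> ^ m * (beta_transformation \<beta> ^^ Suc i) 1 < 1"
    using assms(3) by (rule le_less_trans)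
  then have "\<forall>k<m. renyi_expansion \<beta> !! (Suc i + k) = 0"
    using assms(1) by (simp only: zeros_after_renyi_digit_iff)
  moreover have "j = Suc i + (j - Suc i)" "j - Suc i < m"
    using assms by auto
  ultimately show ?thesis by metis
qed

section \<open>The trinomial root as a bound on the base\<close>

lemma less_inverse_theta_iff:
  assumes "m \<ge> 2" "\<beta> > 1"
  shows "\<beta> < inverse (theta m) \<longleftrightarrow> \<beta> ^ (m - 1) * (\<beta> - 1) < 1"
proof -
  define t where "t = theta m"
  have t: "0 < t" "t + t ^ m = 1"
    using theI'[OF theta_ex1[OF assms(1)]] by (auto simp: t_def theta_def)
  define x where "x = inverse \<beta>"
  have x: "0 < x" using assms by (simp add: x_def)
  have "\<beta> < inverse t \<longleftrightarrow> t < x"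
    using t assms by (simp add: x_def field_simps)
  \<comment> \<open>The map \<open>x + x ^ m\<close> is strictly increasing on positive reals and
    takes the value 1 at \<open>t\<close>.\<close>
  also have "\<dots> \<longleftrightarrow> 1 < x + x ^ m"
  proof
    assume "t < x"
    moreover from this have "t ^ m \<le> x ^ m" using t by (intro power_mono) auto
    ultimately show "1 < x + x ^ m" using t by linarith
  next
    assume *: "1 < x + x ^ m"
    show "t < x"
    proof (rule ccontr)
      assume "\<not> t < x"
      moreover from this have "x ^ m \<le> t ^ m" using x by (intro power_mono) auto
      ultimately show False using t * by linarith
    qed
  qed
  also have "\<dots> \<longleftrightarrow> \<beta> ^ m < \<beta> ^ (m - 1) + 1"
  proof -
    have "\<beta> ^ m * (x + x ^ m) = \<beta> ^ (m - 1) + 1"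
      using assms by (simp add: x_def distrib_left power_diff power_inverse divide_inverse)
    moreover have "1 < x + x ^ m \<longleftrightarrow> \<beta> ^ m * 1 < \<beta> ^ m * (x + x ^ m)"
      using assms by (subst mult_less_cancel_left_pos) auto
    ultimately show ?thesis by simp
  qed
  also have "\<dots> \<longleftrightarrow> \<beta> ^ (m - 1) * (\<beta> - 1) < 1"
    using assms by (cases m) (auto simp: algebra_simps)
  finally show ?thesis by (simp add: t_def)
qed

section \<open>Digit streams with isolated ones\<close>

text \<open>Both streams peel off the same block \<open>w k\<close>. Blocks are nonempty, so peeling
  strictly lowers the position still to be compared, which justifies induction on the position for
  all \<open>k\<close> at once.\<close>

lemma flat_smap_fromN:
  assumes "\<And>k. m \<le> k \<Longrightarrow> S k = w k @- S (Suc k)" "\<And>k. w k \<noteq> []"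
  shows "S m = flat (smap w (fromN m))"
proof -
  have "S k !! i = flat (smap w (fromN k)) !! i" if "m \<le> k" for i k
    using that
  proof (induction i arbitrary: k rule: less_induct)
    case (less i)
    have flat: "flat (smap w (fromN k)) = w k @- flat (smap w (fromN (Suc k)))"
      using assms(2)[of k] flat_unfold[of "smap w (fromN k)"] by simp
    show ?case
    proof (cases "i < length (w k)")
      case True
      then show ?thesis by (simp add: flat assms(1)[OF less.prems])
    next
      case False
      moreover have "i - length (w k) < i" using False assms(2)[of k] by (cases i) auto
      ultimately show ?thesis
        using less.IH[of "i - length (w k)" "Suc k"] less.prems
        by (simp add: flat assms(1)[OF less.prems])
    qed
  qed
  then have "\<forall>i. S m !! i = flat (smap w (fromN m)) !! i" by simp
  \<comment> \<open>Pointwise equality gives equality of streams by reading \<open>s\<close> as its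
    image under the identity map.\<close>
  then show ?thesis by (metis smap_alt stream.map_id0 id_apply)
qed

lemma shift_concat_upt:
  assumes "\<And>k. a \<le> k \<Longrightarrow> k < b \<Longrightarrow> S k = w k @- S (Suc k)" "a \<le> b"
  shows "S a = concat (map w [a..<b]) @- S b"
  using assms(2,1) by (induction b rule: dec_induct) auto

text \<open>Stating the gaps by positions instead of blocks makes the property pass directly to
  every tail that starts at a 1.\<close>

definition isolated_ones :: "nat \<Rightarrow> int stream \<Rightarrow> bool" where
  "isolated_ones m s \<longleftrightarrow> s !! 0 = 1 \<and> (\<forall>i. s !! i \<in> {0, 1}) \<and>
     (\<forall>i j. s !! i = 1 \<longrightarrow> i < j \<longrightarrow> j \<le> i + m \<longrightarrow> s !! j = 0)"

lemma isolated_ones_sdrop: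
  assumes "\<And>i. s !! i \<in> {0, 1}"
    and "\<And>i j. s !! i = 1 \<Longrightarrow> i < j \<Longrightarrow> j \<le> i + m \<Longrightarrow> s !! j = 0"
    and "s !! p = 1"
  shows "isolated_ones m (sdrop p s)"
  unfolding isolated_ones_def sdrop_snth
  using assms(3) assms(1) assms(2)[of "p + i" "p + j" for i j] by auto

text \<open>Once the terminal stream is excluded, another 1 must occur. Cutting just before the next
  1 leaves a stream of the same kind, so the split can be iterated.\<close>

lemma isolated_ones_split:
  assumes "isolated_ones m s" "s \<noteq> [1] @- sconst 0"
  obtains k s' where "m \<le> k" "s = (1 # zeros k) @- s'" "isolated_ones m s'"
proof -
  have bin: "s !! i \<in> {0, 1}" for i using assms(1) by (simp add: isolated_ones_def)
  have gap: "s !! j = 0" if "s !! i = 1" "i < j" "j \<le> i + m" for i j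
    using assms(1) that unfolding isolated_ones_def by blast
  have hd: "s !! 0 = 1" using assms(1) by (simp add: isolated_ones_def)
  have "\<exists>k. s !! Suc k = 1"
  proof (rule ccontr)
    assume "\<nexists>k. s !! Suc k = 1"
    then have "s !! i = ([1] @- sconst 0) !! i" for i
      using bin[of i] hd by (cases i) auto
    then have "s = [1] @- sconst 0" by (metis smap_alt stream.map_id0 id_apply)
    then show False using assms(2) by contradiction
  qed
  define k where "k = (LEAST k. s !! Suc k = 1)"
  have k: "s !! Suc k = 1" unfolding k_def by (rule LeastI_ex) fact
  have less_k: "s !! Suc i = 0" if "i < k" for i
    using not_less_Least[of i "\<lambda>k. s !! Suc k = 1"] that bin[of "Suc i"] by (auto simp: k_def)
  show thesis
  proof
    show "m \<le> k" using gap[OF hd, of "Suc k"] k by (cases "m \<le> k") auto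
    have "stake (Suc k) s = 1 # zeros k"
      using hd less_k by (intro nth_equalityI) (auto simp: nth_Cons less_Suc_eq_0_disj
        simp del: stake.simps split: nat.split)
    then show "s = (1 # zeros k) @- sdrop (Suc k) s"
      using stake_sdrop[of "Suc k" s] by (simp only:)
    show "isolated_ones m (sdrop (Suc k) s)"
      using bin gap k by (rule isolated_ones_sdrop)
  qed
qed

lemma isolated_ones_decomp:
  assumes "isolated_ones m s"
  shows "\<exists>ns :: nat \<Rightarrow> nat. (\<forall>k. m \<le> ns k) \<and>
    (s = flat (smap (\<lambda>k. 1 # zeros (ns k)) (fromN 1)) \<or>
     (\<exists>K. s = concat (map (\<lambda>k. 1 # zeros (ns k)) [1..<K + 1]) @- [1] @- sconst 0))"
proof -
  \<comment> \<open>The bound \<open>m \<le> k\<close> stands outside the implication, so the chosen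
    \<open>gap\<close> is at least \<open>m\<close> on every stream. Hence all \<open>ns k\<close>
    obey the bound, even those beyond the end of a finite expansion.\<close>
  have "\<forall>s. \<exists>k s'. m \<le> k \<and> (isolated_ones m s \<and> s \<noteq> [1] @- sconst 0 \<longrightarrow>
      s = (1 # zeros k) @- s' \<and> isolated_ones m s')" (is "\<forall>s. \<exists>k s'. ?P s k s'")
  proof
    show "\<exists>k s'. ?P s k s'" for s
      by (cases "isolated_ones m s \<and> s \<noteq> [1] @- sconst 0") (blast elim: isolated_ones_split)+
  qed
  from choice[OF this] obtain gap where "\<forall>s. \<exists>s'. ?P s (gap s) s'" ..
  from choice[OF this] obtain rest where *: "\<forall>s. ?P s (gap s) (rest s)" ..
  have gap: "m \<le> gap s" for s
    using *[THEN spec, of s] by (rule conjunct1)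
  have rest: "s = (1 # zeros (gap s)) @- rest s \<and> isolated_ones m (rest s)"
    if "isolated_ones m s" "s \<noteq> [1] @- sconst 0" for s
    using *[THEN spec, of s, THEN conjunct2] conjI[OF that] by (rule mp)
  \<comment> \<open>Blocks are numbered from 1: \<open>S k\<close> is what remains before block
    \<open>k\<close> is removed.\<close>
  define S where "S k = (rest ^^ (k - 1)) s" for k
  define ns where "ns k = gap (S k)" for k
  let ?w = "\<lambda>k. 1 # zeros (ns k) :: int list"
  have S_Suc: "S (Suc k) = rest (S k)" if "k \<ge> 1" for k
    using that by (cases k) (auto simp: S_def)
  have S1: "S 1 = s" by (simp add: S_def)
  have iso: "isolated_ones m (S (Suc k))" if "\<forall>i<k. S (Suc i) \<noteq> [1] @- sconst 0" for k
    using that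
  proof (induction k)
    case 0
    then show ?case using assms S1 by simp
  next
    case (Suc k)
    have "\<forall>i<k. S (Suc i) \<noteq> [1] @- sconst 0" using Suc.prems less_SucI by blast
    then have "isolated_ones m (S (Suc k))" by (rule Suc.IH)
    moreover have "S (Suc k) \<noteq> [1] @- sconst 0" using Suc.prems lessI by blast
    ultimately have "isolated_ones m (rest (S (Suc k)))" by (rule rest[THEN conjunct2])
    then show ?case by (simp add: S_Suc)
  qed
  have step: "S k = ?w k @- S (Suc k)" if "k \<ge> 1" "\<forall>i<k. S (Suc i) \<noteq> [1] @- sconst 0" for k
  proof -
    obtain l where l: "k = Suc l" using \<open>k \<ge> 1\<close> by (cases k) auto
    then have "isolated_ones m (S k)" "S k \<noteq> [1] @- sconst 0" using that(2) iso[of l] by auto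
    from rest[OF this, THEN conjunct1] show ?thesis
      unfolding ns_def S_Suc[OF \<open>k \<ge> 1\<close>] .
  qed
  have "s = flat (smap ?w (fromN 1)) \<or> (\<exists>K. s = concat (map ?w [1..<K + 1]) @- [1] @- sconst 0)"
  proof (cases "\<exists>K. S (Suc K) = [1] @- sconst 0")
    case False
    then have "S 1 = flat (smap ?w (fromN 1))"
      by (intro flat_smap_fromN step) auto
    then show ?thesis using S1 by simp
  next
    case True
    \<comment> \<open>Splitting is justified only until the terminal stream first appears;
      minimality of \<open>K\<close> makes all \<open>K\<close> blocks before it available.\<close>
    define K where "K = (LEAST K. S (Suc K) = [1] @- sconst 0)"
    have K: "S (Suc K) = [1] @- sconst 0" unfolding K_def using True by (rule LeastI_ex)
    have "\<forall>i<K. S (Suc i) \<noteq> [1] @- sconst 0"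
      unfolding K_def using not_less_Least by blast
    then have "S 1 = concat (map ?w [1..<K + 1]) @- S (K + 1)"
      by (intro shift_concat_upt step) auto
    then have "s = concat (map ?w [1..<K + 1]) @- [1] @- sconst 0"
      by (simp only: S1 K Suc_eq_plus1[symmetric])
    then show ?thesis by blast
  qed
  moreover have "\<forall>k. m \<le> ns k" using gap by (simp add: ns_def)
  ultimately show ?thesis by (intro exI[of _ ns] conjI)
qed

section \<open>The lacunary form and the equivalence\<close>

lemma lacunary_form_prefix:
  assumes "lacunary_form n d" "n \<ge> 1"
  shows "\<forall>j<n - 1. d !! Suc j = 0" "d !! n = 1"
proof -
  obtain ns :: "nat \<Rightarrow> nat" and s where d: "d = (1 # zeros (n - 1)) @- s"
    and s: "s = flat (smap (\<lambda>k. 1 # zeros (ns k)) (fromN 1)) \<or>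
      (\<exists>K. s = concat (map (\<lambda>k. 1 # zeros (ns k)) [1..<K + 1]) @- [1] @- sconst 0)"
    using assms(1) unfolding lacunary_form_def by blast
  \<comment> \<open>The tail supplies the digit at position \<open>n\<close>. It is the head of the
    first block, or the final 1 when \<open>K = 0\<close> and the concatenation is empty.\<close>
  have "shd s = 1"
    using s
  proof
    assume "s = flat (smap (\<lambda>k. 1 # zeros (ns k)) (fromN 1))"
    then show ?thesis by simp
  next
    assume "\<exists>K. s = concat (map (\<lambda>k. 1 # zeros (ns k)) [1..<K + 1]) @- [1] @- sconst 0"
    then obtain K where "s = concat (map (\<lambda>k. 1 # zeros (ns k)) [1..<K + 1]) @- [1] @- sconst 0"
      by blast
    then show ?thesis by (cases K) (simp_all add: upt_conv_Cons del: upt_Suc)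
  qed
  then show "\<forall>j<n - 1. d !! Suc j = 0" "d !! n = 1"
    using assms(2) by (auto simp: d simp del: shift.simps)
qed

theorem mainTheorem2:
  fixes n :: nat and \<beta> :: real
  assumes "n \<ge> 2"
    and "\<beta> \<in> {1<..(1 + sqrt 5) / 2}"
  shows "\<beta> \<in> {inverse (theta (n + 1))..<inverse (theta n)} \<longleftrightarrow> lacunary_form n (renyi_expansion \<beta>)"
proof -
  \<comment> \<open>This puts the golden ratio below 2, so only the digits 0 and 1 occur.\<close>
  have "sqrt 5 < sqrt (3\<^sup>2)" by (subst real_sqrt_less_iff) simp
  then have \<beta>: "1 < \<beta>" "\<beta> < 2" using assms(2) by auto
  define d where "d = renyi_expansion \<beta>"
  have "\<beta> \<in> {inverse (theta (n + 1))..<inverse (theta n)} \<longleftrightarrow>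
      \<beta> ^ (n - 1) * (\<beta> - 1) < 1 \<and> \<beta> ^ n * (\<beta> - 1) \<ge> 1"
    \<comment> \<open>The lower end of the interval is the negated criterion for
      \<open>n + 1\<close>.\<close>
    using less_inverse_theta_iff[of n \<beta>] less_inverse_theta_iff[of "n + 1" \<beta>] assms(1) \<beta> by auto
  also have "\<dots> \<longleftrightarrow> lacunary_form n d"
  proof
    assume "lacunary_form n d"
    then show "\<beta> ^ (n - 1) * (\<beta> - 1) < 1 \<and> \<beta> ^ n * (\<beta> - 1) \<ge> 1"
      using lacunary_form_prefix[of n d] renyi_expansion_prefix_iff[OF \<beta>, of n] assms(1)
      by (simp add: d_def)
  next
    assume *: "\<beta> ^ (n - 1) * (\<beta> - 1) < 1 \<and> \<beta> ^ n * (\<beta> - 1) \<ge> 1"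
    then have prefix: "\<forall>j<n - 1. d !! Suc j = 0" "d !! n = 1"
      using renyi_expansion_prefix_iff[OF \<beta>, of n] assms(1) by (auto simp: d_def)
    have d0: "d !! 0 = 1"
      using \<beta> by (simp add: d_def snth_renyi_expansion floor_eq_iff del: snth.simps)
    have "stake n d = 1 # zeros (n - 1)"
      using prefix(1) d0 assms(1)
      by (intro nth_equalityI) (auto simp: nth_Cons simp del: snth.simps split: nat.split)
    then have split: "d = (1 # zeros (n - 1)) @- sdrop n d"
      using stake_sdrop[of n d] by (simp only:)
    \<comment> \<open>The inequality that produces the first \<open>n - 1\<close> zeros bounds all
      later gaps as well; the tail starts at the second 1.\<close>
    have "isolated_ones (n - 1) (sdrop n d)"
      using snth_renyi_expansion_cases[OF \<beta>] zeros_after_one[OF \<beta>] * prefix(2)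
      unfolding d_def by (intro isolated_ones_sdrop) blast+
    from isolated_ones_decomp[OF this]
    obtain ns :: "nat \<Rightarrow> nat" where "\<forall>k. n - 1 \<le> ns k" and
      "sdrop n d = flat (smap (\<lambda>k. 1 # zeros (ns k)) (fromN 1)) \<or>
       (\<exists>K. sdrop n d = concat (map (\<lambda>k. 1 # zeros (ns k)) [1..<K + 1]) @- [1] @- sconst 0)"
      by blast
    then show "lacunary_form n d"
      unfolding lacunary_form_def using split by (intro exI[of _ ns]) auto
  qed
  finally show ?thesis by (simp add: d_def)
qed

end
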